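(* Suppose that $\nu$ is a probability measure and $m_x\ll\nu$ for all $x\in X$. (1) Suppose that the following holds: given any $\nu$-null set $B$, there exist $x_1,\dots,x_N\in X\setminus B$, $\nu$-measurable sets $\Omega_1,\dots,\Omega_N\subset X$ and $\alpha>0$ such that $X=\bigcup_{i=1}^N\Omega_i$ and $\frac{dm_{x_i}}{d\nu}\ge\alpha>0$ on $\Omega_i$, $i=1,\dots,N$. Then $[X,d,m,\nu]$ satisfies a $(p,p)$-Poincaré inequality for every $p\ge1$. (2) Let $1\le p<q$ and suppose that the following holds: given any $\nu$-null set $B$, there exist $x_1,\dots,x_N\in X\setminus B$ and $\nu$-measurable sets $\Omega_1,\dots,\Omega_N\subset X$ such that $X=\bigcup_{i=1}^N\Omega_i$ and, for $g_i:=\frac{dm_{x_i}}{d\nu}$ on $\Omega_i$, $g_i^{-\frac{p}{q-p}}\in L^1(\Omega_i,\nu)$, $i=1,\dots,N$. Then $[X,d,m,\nu]$ satisfies a $(q,p)$-Poincaré inequality.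
   Context: Metric random walk space: $(X,d)$ is a Polish metric space with its Borel $\sigma$-algebra and $m=(m_x)_{x\in X}$ is a family of Borel probability measures on $X$ such that $x\mapsto m_x(A)$ is Borel for every Borel set $A$, and each $m_x$ has finite first moment ($\int_X d(z,y)\,dm_x(y)<\infty$ for some, hence every, $z\in X$). $\nu$ is a Radon measure on $X$ that is invariant, $\nu(A)=\int_X m_x(A)\,d\nu(x)$, and reversible for $m$: for every Borel $C\subset X\times X$, $\int_X\int_X\chi_C(x,y)\,dm_x(y)d\nu(x)=\int_X\int_X\chi_C(x,y)\,dm_y(x)d\nu(y)$. Put $L_m(A,B)=\int_A\int_B dm_x(y)d\nu(x)$; the space is assumed $m$-connected: $L_m(A,B)>0$ for any $\nu$-measurable sets $A,B$ of positive $\nu$-measure with $A\cup B=X$ (equivalently, when $\nu$ is a probability measure, $\nu$ is ergodic: $\nu(B)\in\{0,1\}$ for every Borel $B$ with $m_x(B)=1$ for all $x\in B$). For $p,q\in[1,\infty)$, $[X,d,m,\nu]$ satisfies a $(q,p)$-Poincaré inequality if there is $c>0$ such that, for any $u\in L^q(X,\nu)$, $$\|u\|_{L^p(X,\nu)}\le c\left(\left(\int_X\int_X|u(y)-u(x)|^q\,dm_x(y)d\nu(x)\right)^{1/q}+\left|\int_X u\,d\nu\right|\right).$$ *)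

theory Defs
  imports "HOL-Analysis.Analysis" "HOL-Probability.Probability"
begin

(* Throughout, nu-measurable means measurable with respect to the completion of the Borel
   measure nu; integrals of nu-measurable functions are taken against the completions. *)

definition metric_random_walk :: "('a::polish_space \<Rightarrow> 'a measure) \<Rightarrow> bool" where
  "metric_random_walk m \<longleftrightarrow>
     (\<forall>x. sets (m x) = sets borel \<and> prob_space (m x)) \<and>
     (\<forall>A\<in>sets borel. (\<lambda>x. emeasure (m x) A) \<in> borel_measurable borel) \<and>
     (\<forall>x. \<exists>z. (\<integral>\<^sup>+ y. ennreal (dist z y) \<partial>m x) < \<infinity>)"

definition radon_measure :: "'a::polish_space measure \<Rightarrow> bool" where
  "radon_measure \<nu> \<longleftrightarrow>
     sets \<nu> = sets borel \<and>
     (\<forall>x. \<exists>U. open U \<and> x \<in> U \<and> emeasure \<nu> U < \<infinity>) \<and>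
     (\<forall>A\<in>sets borel. emeasure \<nu> A = (SUP K\<in>{K. compact K \<and> K \<subseteq> A}. emeasure \<nu> K))"

definition invariant_measure :: "('a::polish_space \<Rightarrow> 'a measure) \<Rightarrow> 'a measure \<Rightarrow> bool" where
  "invariant_measure m \<nu> \<longleftrightarrow>
     (\<forall>A\<in>sets borel. emeasure \<nu> A = (\<integral>\<^sup>+ x. emeasure (m x) A \<partial>\<nu>))"

definition reversible_measure :: "('a::polish_space \<Rightarrow> 'a measure) \<Rightarrow> 'a measure \<Rightarrow> bool" where
  "reversible_measure m \<nu> \<longleftrightarrow>
     (\<forall>C\<in>sets (borel :: ('a \<times> 'a) measure).
        (\<integral>\<^sup>+ x. (\<integral>\<^sup>+ y. indicator C (x, y) \<partial>m x) \<partial>\<nu>) =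
        (\<integral>\<^sup>+ y. (\<integral>\<^sup>+ x. indicator C (x, y) \<partial>m y) \<partial>\<nu>))"

definition m_interaction ::
  "('a::polish_space \<Rightarrow> 'a measure) \<Rightarrow> 'a measure \<Rightarrow> 'a set \<Rightarrow> 'a set \<Rightarrow> ennreal" where
  "m_interaction m \<nu> A B =
     (\<integral>\<^sup>+ x\<in>A. (\<integral>\<^sup>+ y\<in>B. 1 \<partial>completion (m x)) \<partial>completion \<nu>)"

definition m_connected :: "('a::polish_space \<Rightarrow> 'a measure) \<Rightarrow> 'a measure \<Rightarrow> bool" where
  "m_connected m \<nu> \<longleftrightarrow>
     (\<forall>A\<in>sets (completion \<nu>). \<forall>B\<in>sets (completion \<nu>).
        emeasure (completion \<nu>) A > 0 \<longrightarrow> emeasure (completion \<nu>) B > 0 \<longrightarrow> A \<union> B = UNIV \<longrightarrow>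
        m_interaction m \<nu> A B > 0)"

(* Real powers on the extended half line. For a < 0 the value at 0 is infinity, unlike powr on
   the reals, where 0 powr a = 0. *)
definition ennreal_powr :: "ennreal \<Rightarrow> real \<Rightarrow> ennreal" where
  "ennreal_powr x a =
     (if a = 0 then 1
      else if x = 0 then (if a > 0 then 0 else \<infinity>)
      else if x = \<infinity> then (if a > 0 then \<infinity> else 0)
      else ennreal (enn2real x powr a))"

definition Lp_norm :: "real \<Rightarrow> 'a measure \<Rightarrow> ('a \<Rightarrow> real) \<Rightarrow> ennreal" where
  "Lp_norm p \<nu> u = ennreal_powr (\<integral>\<^sup>+ x. ennreal (\<bar>u x\<bar> powr p) \<partial>completion \<nu>) (1 / p)"

definition Lp_space :: "real \<Rightarrow> 'a measure \<Rightarrow> ('a \<Rightarrow> real) set" where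
  "Lp_space p \<nu> = {u \<in> borel_measurable (completion \<nu>). Lp_norm p \<nu> u < \<infinity>}"

(* The inequality is between extended nonnegative reals, so it includes finiteness of the
   L^p norm of u whenever the right-hand side is finite. For finite nu and q at least 1,
   functions in L^q are integrable, so the Bochner integral of u is not a default value. *)
definition poincare_inequality ::
  "('a::polish_space \<Rightarrow> 'a measure) \<Rightarrow> 'a measure \<Rightarrow> real \<Rightarrow> real \<Rightarrow> bool" where
  "poincare_inequality m \<nu> q p \<longleftrightarrow>
     (\<exists>c::real. c > 0 \<and>
        (\<forall>u\<in>Lp_space q \<nu>.
           Lp_norm p \<nu> u \<le>
             ennreal c *
               (ennreal_powr
                  (\<integral>\<^sup>+ x. (\<integral>\<^sup>+ y. ennreal (\<bar>u y - u x\<bar> powr q) \<partial>completion (m x)) \<partial>completion \<nu>)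
                  (1 / q)
                + ennreal \<bar>\<integral>x. u x \<partial>completion \<nu>\<bar>)))"

end

theory Submission
  imports Defs
begin

text \<open>
  The proof is by contradiction and compactness. If the inequality fails for every constant, there are
  Borel functions \<open>w n\<close> with \<open>L\<^sup>p\<close> norm \<open>1\<close>, means tending to \<open>0\<close> and summable energies
  (\<open>normalised_counterexample\<close>). Summability makes the local energies
  \<open>\<integral> \<bar>w n y - w n x\<bar>\<^sup>q dm\<^sub>x(y)\<close> tend to \<open>0\<close> for all \<open>x\<close> outside a \<open>\<nu>\<close>-null set \<open>B\<close>. Now the
  hypothesis is applied to this \<open>B\<close>, which explains why it is made for every null set: it gives finitely
  many points \<open>x\<^sub>i\<close> at which the local energies do tend to \<open>0\<close>. The lower bounds on the density of
  \<open>m\<close> at \<open>x\<^sub>i\<close> turn this into convergence of \<open>w n - w n (x\<^sub>i)\<close> to \<open>0\<close> in \<open>L\<^sup>p(\<Omega>\<^sub>i, \<nu>)\<close>: trivially if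
  the density is at least \<open>\<alpha>\<close> and \<open>q = p\<close>, and by a pointwise Hoelder inequality if a negative power of
  the density is integrable (\<open>Lp_controls_density_bounded_below\<close>,
  \<open>Lp_controls_density_integrable_powr\<close>).
  
  The finitely many sequences \<open>w n (x\<^sub>i)\<close> are bounded, so a subsequence of \<open>w n\<close> converges in \<open>L\<^sup>p\<close> to a
  function \<open>v\<close> with finitely many values (\<open>Lp_limit_with_finite_range\<close>). Fatou's lemma shows that almost
  no step of the walk changes \<open>v\<close> (\<open>AE_constant_on_steps\<close>), and connectedness then makes \<open>v\<close> constant
  (\<open>constant_if_connected\<close>). Its mean is \<open>0\<close>, so \<open>v = 0\<close>, although its \<open>L\<^sup>p\<close> norm is \<open>1\<close>
  (\<open>no_degenerate_sequence\<close>).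
\<close>

section \<open>Elementary estimates and compactness\<close>

lemma powr_add_le:
  fixes a b p :: real
  assumes "0 \<le> a" "0 \<le> b" "0 \<le> p"
  shows "(a + b) powr p \<le> 2 powr p * (a powr p + b powr p)"
proof -
  have "(a + b) powr p \<le> (2 * max a b) powr p"
    using assms by (intro powr_mono2) auto
  also have "\<dots> = 2 powr p * (max a b) powr p"
    using assms by (simp add: powr_mult)
  also have "\<dots> \<le> 2 powr p * (a powr p + b powr p)"
    by (intro mult_left_mono) (auto simp: max_def)
  finally show ?thesis .
qed

text \<open>
  A substitute for Minkowski's inequality: only the convergence of integrals to \<open>0\<close> matters
  below, so the crude factor \<open>2\<^sup>p\<close> is harmless and no \<open>p\<close>-th roots appear.
\<close>

lemma nn_integral_powr_triangle:
  fixes f g :: "'a \<Rightarrow> real"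
  assumes [measurable]: "f \<in> borel_measurable M" "g \<in> borel_measurable M" "A \<in> sets M" and p: "0 \<le> p"
  shows "(\<integral>\<^sup>+x\<in>A. ennreal (\<bar>f x + g x\<bar> powr p) \<partial>M)
    \<le> ennreal (2 powr p) * ((\<integral>\<^sup>+x\<in>A. ennreal (\<bar>f x\<bar> powr p) \<partial>M) + (\<integral>\<^sup>+x\<in>A. ennreal (\<bar>g x\<bar> powr p) \<partial>M))"
proof -
  have "ennreal (\<bar>f x + g x\<bar> powr p) \<le> ennreal (2 powr p) * (ennreal (\<bar>f x\<bar> powr p) + ennreal (\<bar>g x\<bar> powr p))" for x
  proof -
    have "\<bar>f x + g x\<bar> powr p \<le> (\<bar>f x\<bar> + \<bar>g x\<bar>) powr p"
      using p by (intro powr_mono2) auto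
    also have "\<dots> \<le> 2 powr p * (\<bar>f x\<bar> powr p + \<bar>g x\<bar> powr p)"
      using p by (intro powr_add_le) auto
    finally show ?thesis
      by (simp flip: ennreal_plus ennreal_mult add: ennreal_leI)
  qed
  then have "(\<integral>\<^sup>+x\<in>A. ennreal (\<bar>f x + g x\<bar> powr p) \<partial>M) \<le> (\<integral>\<^sup>+x\<in>A. ennreal (2 powr p) * (ennreal (\<bar>f x\<bar> powr p) + ennreal (\<bar>g x\<bar> powr p)) \<partial>M)"
    by (intro nn_integral_mono mult_right_mono) auto
  also have "\<dots> = ennreal (2 powr p) * ((\<integral>\<^sup>+x\<in>A. ennreal (\<bar>f x\<bar> powr p) \<partial>M) + (\<integral>\<^sup>+x\<in>A. ennreal (\<bar>g x\<bar> powr p) \<partial>M))"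
    by (simp add: mult.assoc distrib_left distrib_right nn_integral_cmult nn_integral_add)
  finally show ?thesis .
qed

lemma tendsto_0_if_le_small_plus_multiple:
  fixes a b :: "nat \<Rightarrow> ennreal"
  assumes a: "a \<longlonglongrightarrow> 0"
    and b: "\<And>e::real. e > 0 \<Longrightarrow> \<exists>K::real. \<forall>n. b n \<le> ennreal e + ennreal K * a n"
  shows "b \<longlonglongrightarrow> 0"
proof (rule order_tendstoI)
  fix c :: ennreal assume "0 < c"
  then obtain d where d: "0 < d" "d < c" using dense by blast
  define e where "e = enn2real d / 2"
  have dtop: "d < top" using d(2) by (rule order.strict_trans2) simp
  then have de: "d = ennreal (e + e)" "e > 0"
    using d(1) by (auto simp: e_def enn2real_positive_iff)
  obtain K :: real where K: "\<And>n. b n \<le> ennreal e + ennreal K * a n" using b[OF de(2)] by blast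
  have "(\<lambda>n. ennreal K * a n) \<longlonglongrightarrow> ennreal K * 0"
    by (intro ennreal_tendsto_cmult a) auto
  then have "eventually (\<lambda>n. ennreal K * a n < ennreal e) sequentially"
    using de(2) by (intro order_tendstoD(2)) auto
  then show "eventually (\<lambda>n. b n < c) sequentially"
  proof eventually_elim
    case (elim n)
    have "b n \<le> ennreal e + ennreal e" using K[of n] elim by (meson add_left_mono less_imp_le order_trans)
    also have "\<dots> = d" using de by (simp flip: ennreal_plus)
    finally show ?case using d by simp
  qed
qed auto

text \<open>
  Bolzano-Weierstrass in \<open>\<real>\<^sup>I\<close>. The index set is finite but not a type, because the number of
  sets in a cover is only known inside the proof.
\<close>

lemma finite_family_convergent_subseq:
  fixes a :: "nat \<Rightarrow> 'i \<Rightarrow> real"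
  assumes "finite I" "\<And>i. i \<in> I \<Longrightarrow> Bseq (\<lambda>n. a n i)"
  shows "\<exists>r::nat\<Rightarrow>nat. strict_mono r \<and> (\<forall>i\<in>I. convergent (\<lambda>n. a (r n) i))"
  using assms
proof (induction I rule: finite_induct)
  case empty
  then show ?case using strict_mono_id by blast
next
  case (insert j I)
  then obtain r where r: "strict_mono r" "\<forall>i\<in>I. convergent (\<lambda>n. a (r n) i)" by blast
  have "Bseq (\<lambda>n. a (r n) j)" using insert.prems[of j] r(1)
    using Bseq_subseq[of "\<lambda>n. a n j" r] by simp
  then have "bounded (range (\<lambda>n. a (r n) j))" using Bseq_eq_bounded by blast
  then obtain s l where s: "strict_mono s" "((\<lambda>n. a (r n) j) \<circ> s) \<longlonglongrightarrow> l"
    using bounded_imp_convergent_subsequence by blast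
  have "convergent (\<lambda>n. a (r (s n)) i)" if "i \<in> I" for i
    using convergent_subseq_convergent[of "\<lambda>n. a (r n) i" s] r(2) that s(1) by (auto simp: o_def)
  moreover have "convergent (\<lambda>n. a (r (s n)) j)"
    using s(2) by (auto simp: o_def convergent_def)
  ultimately show ?case
    using strict_mono_o[OF r(1) s(1)] by (intro exI[of _ "r \<circ> s"]) (auto simp: o_def)
qed

section \<open>Control of one Lp distance by another\<close>

text \<open>
  This is all that the proof uses of the lower bounds on the density of \<open>\<mu>\<close>: a sequence that tends
  to \<open>0\<close> in \<open>L\<^sup>q(\<mu>)\<close> tends to \<open>0\<close> in \<open>L\<^sup>p(\<Omega>, \<nu>)\<close>. Both kinds of lower bound in the theorem imply
  it, so the two parts have one proof from here on.
\<close>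

definition Lp_controls :: "real \<Rightarrow> real \<Rightarrow> 'a measure \<Rightarrow> 'a measure \<Rightarrow> 'a set \<Rightarrow> bool" where
  "Lp_controls q p \<mu> \<nu> \<Omega> \<longleftrightarrow>
     (\<forall>f :: nat \<Rightarrow> 'a \<Rightarrow> real. (\<forall>n. f n \<in> borel_measurable \<nu>) \<longrightarrow>
        (\<lambda>n. \<integral>\<^sup>+y. ennreal (\<bar>f n y\<bar> powr q) \<partial>\<mu>) \<longlonglongrightarrow> 0 \<longrightarrow>
        (\<lambda>n. \<integral>\<^sup>+y\<in>\<Omega>. ennreal (\<bar>f n y\<bar> powr p) \<partial>\<nu>) \<longlonglongrightarrow> 0)"

text \<open>
  On \<open>\<Omega>\<close> the measure \<open>\<nu>\<close> is at most \<open>1 / \<alpha>\<close> times the measure with density \<open>g\<close>.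
\<close>

lemma Lp_controls_density_bounded_below:
  assumes [measurable]: "g \<in> borel_measurable \<nu>" and \<alpha>: "\<alpha> > 0"
    and g: "AE y in \<nu>. y \<in> \<Omega> \<longrightarrow> ennreal \<alpha> \<le> g y"
  shows "Lp_controls p p (density \<nu> g) \<nu> \<Omega>"
  unfolding Lp_controls_def
proof (intro allI impI)
  fix f :: "nat \<Rightarrow> 'a \<Rightarrow> real"
  assume "\<forall>n. f n \<in> borel_measurable \<nu>"
    and lim: "(\<lambda>n. \<integral>\<^sup>+y. ennreal (\<bar>f n y\<bar> powr p) \<partial>density \<nu> g) \<longlonglongrightarrow> 0"
  then have [measurable]: "f n \<in> borel_measurable \<nu>" for n by auto
  have "(\<integral>\<^sup>+y\<in>\<Omega>. ennreal (\<bar>f n y\<bar> powr p) \<partial>\<nu>) \<le> ennreal (1 / \<alpha>) * (\<integral>\<^sup>+y. ennreal (\<bar>f n y\<bar> powr p) \<partial>density \<nu> g)" for n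
  proof -
    have "(\<integral>\<^sup>+y\<in>\<Omega>. ennreal (\<bar>f n y\<bar> powr p) \<partial>\<nu>) \<le> (\<integral>\<^sup>+y. ennreal (1 / \<alpha>) * (g y * ennreal (\<bar>f n y\<bar> powr p)) \<partial>\<nu>)"
      using g
    proof (intro nn_integral_mono_AE, eventually_elim)
      case (elim y)
      show ?case
      proof (cases "y \<in> \<Omega>")
        case True
        have "ennreal (\<bar>f n y\<bar> powr p) = ennreal (1 / \<alpha>) * (ennreal \<alpha> * ennreal (\<bar>f n y\<bar> powr p))"
          using \<alpha> by (simp flip: ennreal_mult)
        also have "\<dots> \<le> ennreal (1 / \<alpha>) * (g y * ennreal (\<bar>f n y\<bar> powr p))"
          using elim True by (intro mult_left_mono mult_right_mono) auto
        finally show ?thesis using True by simp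
      qed simp
    qed
    then show ?thesis by (simp add: nn_integral_cmult nn_integral_density)
  qed
  then show "(\<lambda>n. \<integral>\<^sup>+y\<in>\<Omega>. ennreal (\<bar>f n y\<bar> powr p) \<partial>\<nu>) \<longlonglongrightarrow> 0"
    by (intro tendsto_0_if_le_small_plus_multiple[OF lim]) (meson add_increasing zero_le)
qed

lemma measurable_ennreal_powr [measurable]:
  "(\<lambda>x. ennreal_powr x a) \<in> borel_measurable borel"
  unfolding ennreal_powr_def by measurable

text \<open>
  A pointwise form of Hoelder's inequality with exponents \<open>q / p\<close> and \<open>q / (q - p)\<close>, free of roots
  of integrals. With \<open>k = 1 / (q - p)\<close>, the first term bounds \<open>t\<^sup>p\<close> where \<open>t \<le> \<delta> g\<^bsup>-k\<^esup>\<close>; where \<open>t\<close>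
  is larger, \<open>t\<^bsup>q-p\<^esup> \<ge> \<delta>\<^bsup>q-p\<^esup> / g\<close>, and multiplying by \<open>t\<^sup>p\<close> gives the second term.
  At \<open>g = 0\<close> and \<open>g = \<infinity>\<close> the right-hand side is infinite unless \<open>t = 0\<close>.
\<close>

lemma powr_weighted_interpolation:
  fixes t \<delta> p q :: real and g :: ennreal
  assumes t: "0 \<le> t" and \<delta>: "0 < \<delta>" and p: "0 < p" "p < q"
  shows "ennreal (t powr p) \<le>
    ennreal (\<delta> powr p) * ennreal_powr g (- (p / (q - p))) + ennreal (\<delta> powr (p - q)) * (g * ennreal (t powr q))"
proof -
  consider "t = 0" | "t > 0" "g = 0" | "t > 0" "g = \<infinity>" | s where "t > 0" "s > 0" "g = ennreal s"
    using t by (cases g; cases "t = 0"; force simp: less_le)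
  then show ?thesis
  proof cases
    case 2
    then show ?thesis using p \<delta> by (simp add: divide_less_0_iff ennreal_powr_def ennreal_mult_top)
  next
    case 3
    then show ?thesis using p \<delta> by (simp add: ennreal_powr_def ennreal_mult_top ennreal_top_mult)
  next
    case (4 s)
    define k where "k = 1 / (q - p)"
    have "t powr p \<le> \<delta> powr p * s powr (- (p * k)) + \<delta> powr (p - q) * (s * t powr q)"
    proof (cases "t \<le> \<delta> * s powr (- k)")
      case True
      then have "t powr p \<le> (\<delta> * s powr (- k)) powr p"
        using t p by (intro powr_mono2) auto
      also have "\<dots> = \<delta> powr p * s powr (- (p * k))"
        using \<delta> by (simp add: powr_mult powr_powr mult.commute)
      finally show ?thesis using 4 by (simp add: add_increasing2)
    next
      case False
      have "\<delta> powr (q - p) * s powr (-1) = (\<delta> * s powr (- k)) powr (q - p)"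
        using \<delta> p by (simp add: powr_mult powr_powr k_def)
      also have "\<dots> \<le> t powr (q - p)"
        using False p \<delta> by (intro powr_mono2) auto
      finally have "t powr p * (\<delta> powr (q - p) * s powr (-1)) * (\<delta> powr (p - q) * s)
          \<le> t powr p * t powr (q - p) * (\<delta> powr (p - q) * s)"
        using 4 by (intro mult_right_mono mult_left_mono) auto
      moreover have "s powr (-1) * s = 1" using 4 by (simp add: powr_minus field_simps)
      moreover have "\<delta> powr (q - p) * \<delta> powr (p - q) = 1" using \<delta> by (simp flip: powr_add)
      moreover have "t powr p * t powr (q - p) = t powr q" by (simp flip: powr_add)
      ultimately have "t powr p \<le> \<delta> powr (p - q) * (s * t powr q)"
        by (metis (no_types, opaque_lifting) mult.commute mult.left_commute mult.right_neutral)
      then show ?thesis by (simp add: add_increasing)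
    qed
    then show ?thesis using 4 p \<delta>
      by (simp add: ennreal_powr_def k_def flip: ennreal_mult ennreal_plus)
  qed simp
qed

text \<open>
  Integrated over \<open>\<Omega>\<close>, the interpolation inequality bounds the \<open>L\<^sup>p(\<nu>)\<close> integral by \<open>\<delta>\<^sup>p\<close> times a
  fixed finite number plus a multiple of the \<open>L\<^sup>q(g\<nu>)\<close> integral, and \<open>\<delta>\<close> is arbitrary.
\<close>

lemma Lp_controls_density_integrable_powr:
  assumes [measurable]: "g \<in> borel_measurable \<nu>" "\<Omega> \<in> sets \<nu>" and p: "0 < p" "p < q"
    and fin: "(\<integral>\<^sup>+y\<in>\<Omega>. ennreal_powr (g y) (- (p / (q - p))) \<partial>\<nu>) < \<infinity>" (is "?H < _")
  shows "Lp_controls q p (density \<nu> g) \<nu> \<Omega>"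
  unfolding Lp_controls_def
proof (intro allI impI)
  fix f :: "nat \<Rightarrow> 'a \<Rightarrow> real"
  assume "\<forall>n. f n \<in> borel_measurable \<nu>"
    and lim: "(\<lambda>n. \<integral>\<^sup>+y. ennreal (\<bar>f n y\<bar> powr q) \<partial>density \<nu> g) \<longlonglongrightarrow> 0"
  then have [measurable]: "f n \<in> borel_measurable \<nu>" for n by auto
  have bound: "(\<integral>\<^sup>+y\<in>\<Omega>. ennreal (\<bar>f n y\<bar> powr p) \<partial>\<nu>)
      \<le> ennreal (\<delta> powr p) * ?H + ennreal (\<delta> powr (p - q)) * (\<integral>\<^sup>+y. ennreal (\<bar>f n y\<bar> powr q) \<partial>density \<nu> g)"
    if \<delta>: "\<delta> > 0" for \<delta> n
  proof -
    have "(\<integral>\<^sup>+y\<in>\<Omega>. ennreal (\<bar>f n y\<bar> powr p) \<partial>\<nu>)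
        \<le> (\<integral>\<^sup>+y. ennreal (\<delta> powr p) * (ennreal_powr (g y) (- (p / (q - p))) * indicator \<Omega> y)
               + ennreal (\<delta> powr (p - q)) * (g y * ennreal (\<bar>f n y\<bar> powr q)) \<partial>\<nu>)"
      by (intro nn_integral_mono)
        (use powr_weighted_interpolation[OF abs_ge_zero \<delta> p] in \<open>auto split: split_indicator\<close>)
    also have "\<dots> = ennreal (\<delta> powr p) * ?H + ennreal (\<delta> powr (p - q)) * (\<integral>\<^sup>+y. g y * ennreal (\<bar>f n y\<bar> powr q) \<partial>\<nu>)"
      by (simp add: nn_integral_add nn_integral_cmult)
    finally show ?thesis by (simp add: nn_integral_density)
  qed
  show "(\<lambda>n. \<integral>\<^sup>+y\<in>\<Omega>. ennreal (\<bar>f n y\<bar> powr p) \<partial>\<nu>) \<longlonglongrightarrow> 0"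
  proof (rule tendsto_0_if_le_small_plus_multiple[OF lim])
    fix e :: real assume e: "e > 0"
    obtain h where h: "?H = ennreal h" "h \<ge> 0" using fin by (cases ?H) auto
    \<comment> \<open>This \<open>\<delta>\<close> makes \<open>\<delta>\<^sup>p h \<le> e\<close>; adding \<open>1\<close> covers \<open>h = 0\<close>.\<close>
    define \<delta> where "\<delta> = (e / (h + 1)) powr (1 / p)"
    have "\<delta> powr p * h = e / (h + 1) * h" using p e h by (simp add: \<delta>_def powr_powr)
    also have "\<dots> \<le> e" using e h by (simp add: field_simps)
    finally have "ennreal (\<delta> powr p) * ?H \<le> ennreal e"
      using h e by (simp flip: ennreal_mult)
    moreover have "\<delta> > 0" using e h by (simp add: \<delta>_def)
    ultimately show "\<exists>K::real. \<forall>n. (\<integral>\<^sup>+y\<in>\<Omega>. ennreal (\<bar>f n y\<bar> powr p) \<partial>\<nu>)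
        \<le> ennreal e + ennreal K * (\<integral>\<^sup>+y. ennreal (\<bar>f n y\<bar> powr q) \<partial>density \<nu> g)"
      using order_trans[OF bound add_right_mono] by blast
  qed
qed

text \<open>
  The inclusion of \<open>L\<^sup>q\<close> in \<open>L\<^sup>p\<close> for a finite measure is the case of constant density \<open>1\<close>.
\<close>

lemma Lp_controls_self:
  assumes "finite_measure \<nu>" and p: "0 < p" "p \<le> q"
  shows "Lp_controls q p \<nu> \<nu> (space \<nu>)"
proof -
  interpret finite_measure \<nu> by fact
  have d: "density \<nu> (\<lambda>_. 1) = \<nu>" by (simp add: density_1)
  show ?thesis
  proof (cases "p = q")
    case True
    then show ?thesis
      using Lp_controls_density_bounded_below[of "\<lambda>_. 1" \<nu> 1 "space \<nu>" p] d by simp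
  next
    case False
    moreover have "(\<integral>\<^sup>+y\<in>space \<nu>. ennreal_powr 1 (- (p / (q - p))) \<partial>\<nu>) < \<infinity>"
      using emeasure_finite[of "space \<nu>"] by (simp add: ennreal_powr_def less_top[symmetric])
    ultimately show ?thesis
      using Lp_controls_density_integrable_powr[of "\<lambda>_. 1" \<nu> "space \<nu>" p q] d p by simp
  qed
qed

section \<open>Random walks with absolutely continuous steps\<close>

locale ac_random_walk = prob_space \<nu> for \<nu> :: "'a::polish_space measure" +
  fixes m :: "'a \<Rightarrow> 'a measure"
  assumes sets_nu [measurable_cong]: "sets \<nu> = sets borel"
    and kernel: "m \<in> \<nu> \<rightarrow>\<^sub>M prob_algebra borel"
    and ac: "\<And>x. absolutely_continuous \<nu> (m x)"
begin

lemma space_nu [simp]: "space \<nu> = UNIV"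
  using sets_eq_imp_space_eq[OF sets_nu] by simp

lemma sets_m [measurable_cong, simp]: "sets (m x) = sets borel"
  using measurable_space[OF kernel, of x] by (auto simp: space_prob_algebra)

lemma space_m [simp]: "space (m x) = UNIV"
  using sets_eq_imp_space_eq[OF sets_m] by simp

lemma density_m: "density \<nu> (RN_deriv \<nu> (m x)) = m x"
  by (rule density_RN_deriv) (auto simp: ac sets_nu)

lemma AE_m: "AE y in \<nu>. P y \<Longrightarrow> AE y in m x. P y"
  by (rule absolutely_continuous_AE[OF _ ac]) (auto simp: sets_nu)

text \<open>
  The inner integral of the energy, as a function of the starting point. It is evaluated at single
  points \<open>x\<^sub>i\<close>, so it must be a genuine function and not a class modulo null sets.
\<close>

definition local_energy :: "real \<Rightarrow> ('a \<Rightarrow> real) \<Rightarrow> 'a \<Rightarrow> ennreal" where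
  "local_energy q u x = (\<integral>\<^sup>+ y. ennreal (\<bar>u y - u x\<bar> powr q) \<partial>m x)"

lemma measurable_local_energy [measurable]:
  assumes [measurable]: "u \<in> borel_measurable borel"
  shows "local_energy q u \<in> borel_measurable borel"
proof -
  have "(\<lambda>x. \<integral>\<^sup>+ y. ennreal (\<bar>u y - u x\<bar> powr q) \<partial>m x) \<in> borel_measurable \<nu>"
    by (rule nn_integral_measurable_subprob_algebra2[where N=borel])
      (use measurable_prob_algebraD[OF kernel] in \<open>measurable\<close>)
  then show ?thesis
    by (simp add: local_energy_def[abs_def] measurable_cong_sets[OF sets_nu refl])
qed

text \<open>
  Almost everywhere convergence under \<open>\<nu>\<close> is almost everywhere convergence under every \<open>m x\<close>, so
  Fatou's lemma for \<open>m x\<close> bounds the local energy of the limit by the limit of the local energies.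
\<close>

lemma AE_constant_on_steps:
  assumes [measurable]: "\<And>n. w n \<in> borel_measurable borel" "v \<in> borel_measurable borel"
    and q: "0 < q"
    and energy: "AE x in \<nu>. (\<lambda>n. local_energy q (w n) x) \<longlonglongrightarrow> 0"
    and lim: "AE x in \<nu>. (\<lambda>n. w n x) \<longlonglongrightarrow> v x"
  shows "AE x in \<nu>. AE y in m x. v y = v x"
  using energy lim
proof eventually_elim
  case (elim x)
  have "local_energy q v x \<le> (\<integral>\<^sup>+ y. liminf (\<lambda>n. ennreal (\<bar>w n y - w n x\<bar> powr q)) \<partial>m x)"
    unfolding local_energy_def
  proof (rule nn_integral_mono_AE, use AE_m[OF lim, of x] in eventually_elim)
    fix y assume "(\<lambda>n. w n y) \<longlonglongrightarrow> v y"
    then have "(\<lambda>n. ennreal (\<bar>w n y - w n x\<bar> powr q)) \<longlonglongrightarrow> ennreal (\<bar>v y - v x\<bar> powr q)"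
      using elim(2) q by (intro tendsto_ennrealI tendsto_powr' tendsto_intros) auto
    then show "ennreal (\<bar>v y - v x\<bar> powr q) \<le> liminf (\<lambda>n. ennreal (\<bar>w n y - w n x\<bar> powr q))"
      by (intro eq_refl lim_imp_Liminf[symmetric]) auto
  qed
  also have "\<dots> \<le> liminf (\<lambda>n. local_energy q (w n) x)"
    unfolding local_energy_def by (rule nn_integral_liminf) measurable
  also have "\<dots> = 0" using elim(1) by (simp add: lim_imp_Liminf)
  finally have "(\<integral>\<^sup>+ y. ennreal (\<bar>v y - v x\<bar> powr q) \<partial>m x) = 0"
    by (simp add: local_energy_def)
  then show ?case
    by (subst (asm) nn_integral_0_iff_AE) (auto simp: ennreal_eq_0_iff powr_def elim: eventually_mono)
qed

text \<open>
  A level set of positive measure and its complement do not interact if almost no step changes the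
  value of \<open>v\<close>; connectedness makes the complement null. That \<open>v\<close> has countably many values is what
  provides a level set of positive measure.
\<close>

lemma constant_if_connected:
  fixes v :: "'a \<Rightarrow> real"
  assumes conn: "m_connected m \<nu>"
    and [measurable]: "v \<in> borel_measurable borel"
    and "countable \<Lambda>" "AE x in \<nu>. v x \<in> \<Lambda>"
    and steps: "AE x in \<nu>. AE y in m x. v y = v x"
  shows "\<exists>c. AE x in \<nu>. v x = c"
proof -
  have "\<exists>c\<in>\<Lambda>. \<not> (AE x in \<nu>. v x \<noteq> c)"
  proof (rule ccontr)
    assume "\<not> ?thesis"
    then have "AE x in \<nu>. \<forall>c\<in>\<Lambda>. v x \<noteq> c"
      using \<open>countable \<Lambda>\<close> by (subst AE_ball_countable) auto
    with assms(4) have "AE x in \<nu>. False" by eventually_elim auto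
    then show False by simp
  qed
  then obtain c where c: "\<not> (AE x in \<nu>. v x \<noteq> c)" by blast
  define A where "A = {x. v x = c}"
  have "A = v -` {c} \<inter> space borel" by (auto simp: A_def)
  then have A [measurable]: "A \<in> sets borel" "- A \<in> sets borel"
    using measurable_sets_borel[OF assms(2) borel_closed[OF closed_singleton[of c]]] by (auto simp: borel_comp)
  have "emeasure \<nu> A \<noteq> 0"
    using c A(1) AE_iff_measurable[of A \<nu> "\<lambda>x. v x \<noteq> c"] by (auto simp: A_def sets_nu)
  have "m_interaction m \<nu> A (- A) = (\<integral>\<^sup>+ x\<in>A. emeasure (m x) (- A) \<partial>\<nu>)"
    using A by (simp add: m_interaction_def nn_integral_completion)
  also have "\<dots> = (\<integral>\<^sup>+ x. 0 \<partial>\<nu>)"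
  proof (rule nn_integral_cong_AE, use steps in eventually_elim)
    fix x assume "AE y in m x. v y = v x"
    then have "x \<in> A \<Longrightarrow> emeasure (m x) (- A) = 0"
      using A by (subst (asm) AE_iff_measurable[where N = "- {y. v y = v x}"]) (auto simp: A_def Collect_neg_eq)
    then show "emeasure (m x) (- A) * indicator A x = 0"
      by (auto split: split_indicator)
  qed
  finally have "m_interaction m \<nu> A (- A) = 0" by simp
  moreover have "A \<in> sets (completion \<nu>)" "- A \<in> sets (completion \<nu>)"
    using A by (auto simp: sets_nu intro!: sets_completionI_sets)
  ultimately have "emeasure \<nu> (- A) = 0"
    using conn \<open>emeasure \<nu> A \<noteq> 0\<close> A unfolding m_connected_def
    by (metis Compl_partition emeasure_completion main_part not_gr_zero sets_nu)
  then have "AE x in \<nu>. v x = c"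
    using A by (subst AE_iff_measurable[where N = "- A"]) (auto simp: A_def sets_nu)
  then show ?thesis by blast
qed

end

section \<open>Almost everywhere convergence from integrals\<close>

lemma AE_suminf_finite_imp_tendsto_0:
  fixes F :: "nat \<Rightarrow> 'a \<Rightarrow> ennreal"
  assumes [measurable]: "\<And>n. F n \<in> borel_measurable M"
    and "(\<Sum>n. \<integral>\<^sup>+x. F n x \<partial>M) \<noteq> \<infinity>"
  shows "AE x in M. (\<lambda>n. F n x) \<longlonglongrightarrow> 0"
proof -
  have "AE x in M. (\<Sum>n. F n x) \<noteq> \<infinity>"
    using assms by (intro nn_integral_PInf_AE) (auto simp: nn_integral_suminf)
  then show ?thesis
  proof eventually_elim
    case (elim x)
    have fin: "F n x = ennreal (enn2real (F n x))" for n
      using ennreal_suminf_lessD[of "\<lambda>n. F n x" top n] elim by (simp add: less_top)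
    then have "summable (\<lambda>n. enn2real (F n x))"
      using elim by (intro summable_suminf_not_top) auto
    then have "(\<lambda>n. ennreal (enn2real (F n x))) \<longlonglongrightarrow> 0"
      using summable_LIMSEQ_zero by (subst ennreal_tendsto_0_iff) auto
    then show ?case using fin by simp
  qed
qed

lemma L1_tendsto_0_imp_AE_subseq:
  fixes f :: "nat \<Rightarrow> 'a \<Rightarrow> real"
  assumes [measurable]: "\<And>n. f n \<in> borel_measurable M"
    and lim: "(\<lambda>n. \<integral>\<^sup>+x. ennreal \<bar>f n x\<bar> \<partial>M) \<longlonglongrightarrow> 0"
  shows "\<exists>r::nat\<Rightarrow>nat. strict_mono r \<and> (AE x in M. (\<lambda>n. f (r n) x) \<longlonglongrightarrow> 0)"
proof -
  obtain k where k: "\<And>n. n \<ge> k \<Longrightarrow> (\<integral>\<^sup>+x. ennreal \<bar>f n x\<bar> \<partial>M) < 1"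
    using order_tendstoD(2)[OF lim, of 1] by (auto simp: eventually_sequentially)
  have int: "integrable M (f (n + k))" for n
    using k[of "n + k"] by (intro integrableI_bounded) (auto intro: order.strict_trans)
  have "(\<lambda>n. \<integral>\<^sup>+x. ennreal \<bar>f (n + k) x\<bar> \<partial>M) \<longlonglongrightarrow> 0"
    using lim by (rule LIMSEQ_ignore_initial_segment)
  then have "(\<lambda>n. \<integral>x. norm (f (n + k) x) \<partial>M) \<longlonglongrightarrow> 0"
    using int by (simp add: nn_integral_eq_integral ennreal_tendsto_0_iff)
  from tendsto_L1_AE_subseq[OF int this] obtain r where "strict_mono r"
    "AE x in M. (\<lambda>n. f (r n + k) x) \<longlonglongrightarrow> 0" by blast
  then show ?thesis
    by (intro exI[of _ "\<lambda>n. r n + k"]) (auto simp: strict_mono_def)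
qed

context ac_random_walk
begin

section \<open>Compactness of sequences with vanishing energy\<close>

text \<open>
  The sets need only cover the space up to a null set. This allows Borel sets here, although the
  sets in the theorem belong to the completion. The set \<open>B\<close> is to be avoided by the centres \<open>x i\<close>.
\<close>

definition controlled_cover :: "real \<Rightarrow> real \<Rightarrow> 'a set \<Rightarrow> nat set \<Rightarrow> (nat \<Rightarrow> 'a) \<Rightarrow> (nat \<Rightarrow> 'a set) \<Rightarrow> bool" where
  "controlled_cover q p B I x \<Omega> \<longleftrightarrow> finite I \<and>
     (\<forall>i\<in>I. x i \<notin> B \<and> \<Omega> i \<in> sets borel \<and> Lp_controls q p (m (x i)) \<nu> (\<Omega> i)) \<and>
     (AE y in \<nu>. \<exists>i\<in>I. y \<in> \<Omega> i)"

text \<open>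
  The centres \<open>x i\<close> are chosen outside the null set where the local energies fail to tend to \<open>0\<close>.
  Then \<open>w n - w n (x i)\<close> tends to \<open>0\<close> in \<open>L\<^sup>p(\<Omega> i)\<close>. The numbers \<open>w n (x i)\<close> are bounded because
  \<open>w n\<close> is bounded in \<open>L\<^sup>p\<close> and \<open>\<Omega> i\<close> has positive measure, so along a subsequence they converge for all
  \<open>i\<close> at once, and \<open>w n\<close> converges in \<open>L\<^sup>p\<close> to a function that is constant on pieces of the cover.
\<close>

lemma Lp_limit_with_finite_range:
  assumes [measurable]: "\<And>n. w n \<in> borel_measurable borel" and p: "0 < p"
    and norm: "\<And>n. (\<integral>\<^sup>+y. ennreal (\<bar>w n y\<bar> powr p) \<partial>\<nu>) \<le> 1"
    and energy: "AE x in \<nu>. (\<lambda>n. local_energy q (w n) x) \<longlonglongrightarrow> 0"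
    and cover: "\<And>B. B \<in> null_sets \<nu> \<Longrightarrow> \<exists>I x \<Omega>. controlled_cover q p B I x \<Omega>"
  shows "\<exists>r v \<Lambda>. strict_mono (r::nat\<Rightarrow>nat) \<and> v \<in> borel_measurable borel \<and> finite \<Lambda> \<and> (AE y in \<nu>. v y \<in> \<Lambda>) \<and>
    (\<lambda>n. \<integral>\<^sup>+y. ennreal (\<bar>w (r n) y - v y\<bar> powr p) \<partial>\<nu>) \<longlonglongrightarrow> 0"
proof -
  obtain B where B: "B \<in> null_sets \<nu>" "\<And>x. x \<notin> B \<Longrightarrow> (\<lambda>n. local_energy q (w n) x) \<longlonglongrightarrow> 0"
    using AE_E3[OF energy] by auto
  obtain I x \<Omega> where "controlled_cover q p B I x \<Omega>" using cover[OF B(1)] by blast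
  then have I: "finite I" "\<And>i. i \<in> I \<Longrightarrow> x i \<notin> B" "\<And>i. i \<in> I \<Longrightarrow> \<Omega> i \<in> sets borel"
      "\<And>i. i \<in> I \<Longrightarrow> Lp_controls q p (m (x i)) \<nu> (\<Omega> i)"
    and coverI: "AE y in \<nu>. \<exists>i\<in>I. y \<in> \<Omega> i"
    by (auto simp: controlled_cover_def)
  \<comment> \<open>On a null set \<open>\<Omega> i\<close> nothing bounds \<open>w n (x i)\<close>; such sets are dropped from the cover.\<close>
  define J where "J = {i\<in>I. emeasure \<nu> (\<Omega> i) \<noteq> 0}"
  have J: "finite J" "J \<subseteq> I" using I(1) by (auto simp: J_def)
  have [measurable]: "i \<in> J \<Longrightarrow> \<Omega> i \<in> sets borel" for i using I(3) J(2) by auto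
  have "AE y in \<nu>. \<forall>i\<in>I - J. y \<notin> \<Omega> i"
    using I by (intro AE_finite_allI AE_not_in) (auto simp: J_def null_sets_def sets_nu)
  with coverI have coverJ: "AE y in \<nu>. \<exists>i\<in>J. y \<in> \<Omega> i" by eventually_elim auto
  define G where "G n i = (\<integral>\<^sup>+y\<in>\<Omega> i. ennreal (\<bar>w n y - w n (x i)\<bar> powr p) \<partial>\<nu>)" for n i
  have G: "(\<lambda>n. G n i) \<longlonglongrightarrow> 0" if "i \<in> J" for i
  proof -
    have "Lp_controls q p (m (x i)) \<nu> (\<Omega> i)" "x i \<notin> B" using that I J by auto
    then show ?thesis
      using B(2)[of "x i"] unfolding Lp_controls_def local_energy_def G_def
      by (elim allE[of _ "\<lambda>n y. w n y - w n (x i)"]) (auto simp: measurable_cong_sets[OF sets_nu refl])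
  qed
  have "Bseq (\<lambda>n. w n (x i))" if i: "i \<in> J" for i
  proof -
    have [measurable]: "\<Omega> i \<in> sets borel" using i by simp
    define e where "e = measure \<nu> (\<Omega> i)"
    have e: "emeasure \<nu> (\<Omega> i) = ennreal e" "e > 0"
      using i by (auto simp: e_def J_def emeasure_eq_measure zero_less_measure_iff)
    have "eventually (\<lambda>n. norm (w n (x i)) \<le> (2 powr p * 2 / e) powr (1 / p)) sequentially"
      using order_tendstoD(2)[OF G[OF i] zero_less_one]
    proof eventually_elim
      case (elim n)
      \<comment> \<open>Writing the constant as \<open>(w n (x i) - w n) + w n\<close> bounds it by two known integrals.\<close>
      let ?c = "w n (x i)"
      have "ennreal (\<bar>?c\<bar> powr p * e) = (\<integral>\<^sup>+y\<in>\<Omega> i. ennreal (\<bar>(?c - w n y) + w n y\<bar> powr p) \<partial>\<nu>)"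
        using e by (simp add: nn_integral_cmult_indicator sets_nu ennreal_mult)
      also have "\<dots> \<le> ennreal (2 powr p) * ((\<integral>\<^sup>+y\<in>\<Omega> i. ennreal (\<bar>?c - w n y\<bar> powr p) \<partial>\<nu>) + (\<integral>\<^sup>+y\<in>\<Omega> i. ennreal (\<bar>w n y\<bar> powr p) \<partial>\<nu>))"
        using p by (intro nn_integral_powr_triangle) (auto simp: sets_nu)
      also have "(\<integral>\<^sup>+y\<in>\<Omega> i. ennreal (\<bar>?c - w n y\<bar> powr p) \<partial>\<nu>) = G n i"
        by (simp add: G_def abs_minus_commute)
      also have "(\<integral>\<^sup>+y\<in>\<Omega> i. ennreal (\<bar>w n y\<bar> powr p) \<partial>\<nu>) \<le> (\<integral>\<^sup>+y. ennreal (\<bar>w n y\<bar> powr p) \<partial>\<nu>)"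
        by (intro nn_integral_mono) (auto split: split_indicator)
      also have "\<dots> \<le> 1" by (rule norm)
      finally have "ennreal (\<bar>?c\<bar> powr p * e) \<le> ennreal (2 powr p) * (G n i + 1)"
        by (simp add: add_left_mono mult_left_mono)
      also have "\<dots> \<le> ennreal (2 powr p) * (1 + 1)"
        using elim by (intro mult_left_mono add_right_mono) auto
      also have "\<dots> = ennreal (2 powr p * 2)"
        by (simp add: ennreal_mult)
      finally have "\<bar>?c\<bar> powr p \<le> 2 powr p * 2 / e"
        using e(2) by (simp add: field_simps)
      then have "(\<bar>?c\<bar> powr p) powr (1 / p) \<le> (2 powr p * 2 / e) powr (1 / p)"
        using p by (intro powr_mono2) auto
      then show ?case using p by (simp add: powr_powr)
    qed
    then show ?thesis by (rule BfunI)
  qed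
  from finite_family_convergent_subseq[of J "\<lambda>n i. w n (x i)", OF J(1) this]
  obtain r where r: "strict_mono r" "\<forall>i\<in>J. convergent (\<lambda>n. w (r n) (x i))" by blast
  then obtain l where l: "\<And>i. i \<in> J \<Longrightarrow> (\<lambda>n. w (r n) (x i)) \<longlonglongrightarrow> l i"
    unfolding convergent_def by metis
  \<comment> \<open>Where the sets overlap, the least index decides.\<close>
  define v where "v y = l (LEAST i. i \<in> J \<and> y \<in> \<Omega> i)" for y
  have "Measurable.pred borel (\<lambda>y. i \<in> J \<and> y \<in> \<Omega> i)" for i
    by (cases "i \<in> J") auto
  then have [measurable]: "v \<in> borel_measurable borel"
    unfolding v_def by measurable
  have v_in: "\<exists>i\<in>J. y \<in> \<Omega> i \<and> v y = l i" if "\<exists>i\<in>J. y \<in> \<Omega> i" for y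
    using LeastI_ex[of "\<lambda>i. i \<in> J \<and> y \<in> \<Omega> i"] that by (auto simp: v_def)
  have sum_lim: "(\<lambda>n. \<Sum>i\<in>J. \<integral>\<^sup>+y\<in>\<Omega> i. ennreal (\<bar>w (r n) y - l i\<bar> powr p) \<partial>\<nu>) \<longlonglongrightarrow> 0"
  proof (rule tendsto_null_sum)
    fix i assume i: "i \<in> J"
    then have [measurable]: "\<Omega> i \<in> sets borel" by simp
    have "(\<lambda>n. ennreal (\<bar>w (r n) (x i) - l i\<bar> powr p)) \<longlonglongrightarrow> ennreal (\<bar>l i - l i\<bar> powr p)"
      using l[OF i] p by (intro tendsto_ennrealI tendsto_powr' tendsto_intros) auto
    then have lim: "(\<lambda>n. ennreal (2 powr p) * (G (r n) i + ennreal (\<bar>w (r n) (x i) - l i\<bar> powr p))) \<longlonglongrightarrow> ennreal (2 powr p) * (0 + 0)"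
      using LIMSEQ_subseq_LIMSEQ[OF G[OF i] r(1)]
      by (intro ennreal_tendsto_cmult tendsto_add) (auto simp: o_def)
    have bound: "(\<integral>\<^sup>+y\<in>\<Omega> i. ennreal (\<bar>w (r n) y - l i\<bar> powr p) \<partial>\<nu>) \<le> ennreal (2 powr p) * (G (r n) i + ennreal (\<bar>w (r n) (x i) - l i\<bar> powr p))" for n
    proof -
      let ?c = "w (r n) (x i)"
      have "(\<integral>\<^sup>+y\<in>\<Omega> i. ennreal (\<bar>(w (r n) y - ?c) + (?c - l i)\<bar> powr p) \<partial>\<nu>)
        \<le> ennreal (2 powr p) * (G (r n) i + (\<integral>\<^sup>+y\<in>\<Omega> i. ennreal (\<bar>?c - l i\<bar> powr p) \<partial>\<nu>))"
        unfolding G_def using p by (intro nn_integral_powr_triangle) (auto simp: sets_nu)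
      also have "(\<integral>\<^sup>+y\<in>\<Omega> i. ennreal (\<bar>?c - l i\<bar> powr p) \<partial>\<nu>) = ennreal (\<bar>?c - l i\<bar> powr p) * emeasure \<nu> (\<Omega> i)"
        by (simp add: nn_integral_cmult_indicator sets_nu)
      also have "\<dots> \<le> ennreal (\<bar>?c - l i\<bar> powr p) * 1"
        by (intro mult_left_mono) (auto simp: emeasure_le_1)
      finally show ?thesis by (simp add: add_left_mono mult_left_mono)
    qed
    show "(\<lambda>n. \<integral>\<^sup>+y\<in>\<Omega> i. ennreal (\<bar>w (r n) y - l i\<bar> powr p) \<partial>\<nu>) \<longlonglongrightarrow> 0"
      by (rule tendsto_sandwich[OF _ _ tendsto_const lim[simplified]]) (use bound in auto)
  qed
  have "(\<integral>\<^sup>+y. ennreal (\<bar>w (r n) y - v y\<bar> powr p) \<partial>\<nu>) \<le> (\<Sum>i\<in>J. \<integral>\<^sup>+y\<in>\<Omega> i. ennreal (\<bar>w (r n) y - l i\<bar> powr p) \<partial>\<nu>)" for n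
  proof -
    have "(\<integral>\<^sup>+y. ennreal (\<bar>w (r n) y - v y\<bar> powr p) \<partial>\<nu>) \<le> (\<integral>\<^sup>+y. (\<Sum>i\<in>J. ennreal (\<bar>w (r n) y - l i\<bar> powr p) * indicator (\<Omega> i) y) \<partial>\<nu>)"
    proof (rule nn_integral_mono_AE, use coverJ in eventually_elim)
      fix y assume "\<exists>i\<in>J. y \<in> \<Omega> i"
      then obtain i where i: "i \<in> J" "y \<in> \<Omega> i" "v y = l i" using v_in by blast
      then have "ennreal (\<bar>w (r n) y - v y\<bar> powr p) = ennreal (\<bar>w (r n) y - l i\<bar> powr p) * indicator (\<Omega> i) y" by simp
      also have "\<dots> \<le> (\<Sum>i\<in>J. ennreal (\<bar>w (r n) y - l i\<bar> powr p) * indicator (\<Omega> i) y)"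
        using i(1) J(1) by (intro member_le_sum) auto
      finally show "ennreal (\<bar>w (r n) y - v y\<bar> powr p) \<le> (\<Sum>i\<in>J. ennreal (\<bar>w (r n) y - l i\<bar> powr p) * indicator (\<Omega> i) y)" .
    qed
    also have "\<dots> = (\<Sum>i\<in>J. \<integral>\<^sup>+y\<in>\<Omega> i. ennreal (\<bar>w (r n) y - l i\<bar> powr p) \<partial>\<nu>)"
      by (intro nn_integral_sum) measurable
    finally show ?thesis .
  qed
  then have "(\<lambda>n. \<integral>\<^sup>+y. ennreal (\<bar>w (r n) y - v y\<bar> powr p) \<partial>\<nu>) \<longlonglongrightarrow> 0"
    by (intro tendsto_sandwich[OF _ _ tendsto_const sum_lim] always_eventually) auto
  moreover have "AE y in \<nu>. v y \<in> l ` J" using coverJ v_in by (auto elim!: eventually_mono)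
  ultimately show ?thesis using r(1) J(1) \<open>v \<in> borel_measurable borel\<close> by blast
qed

lemma Lp_tendsto_0_imp_L1_tendsto_0:
  fixes f :: "nat \<Rightarrow> 'a \<Rightarrow> real"
  assumes "\<And>n. f n \<in> borel_measurable borel" "1 \<le> p"
    and "(\<lambda>n. \<integral>\<^sup>+y. ennreal (\<bar>f n y\<bar> powr p) \<partial>\<nu>) \<longlonglongrightarrow> 0"
  shows "(\<lambda>n. \<integral>\<^sup>+y. ennreal \<bar>f n y\<bar> \<partial>\<nu>) \<longlonglongrightarrow> 0"
  using Lp_controls_self[OF finite_measure_axioms, of 1 p] assms
  by (auto simp: Lp_controls_def finite_measure_axioms measurable_cong_sets[OF sets_nu refl])

text \<open>
  The limit \<open>v\<close> of a subsequence is unchanged by almost every step, hence equals a constant \<open>c\<close>.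
  The means tend to \<open>0\<close>, which gives \<open>c = 0\<close>, while the norms equal to \<open>1\<close> exclude \<open>c = 0\<close>.
  Summability of the energies, rather than convergence to \<open>0\<close>, makes the local energies of the whole
  sequence tend to \<open>0\<close> almost everywhere, without passing to a subsequence.
\<close>

lemma no_degenerate_sequence:
  assumes conn: "m_connected m \<nu>"
    and [measurable]: "\<And>n. w n \<in> borel_measurable borel" and p: "1 \<le> p" "p \<le> q"
    and norm: "\<And>n. (\<integral>\<^sup>+y. ennreal (\<bar>w n y\<bar> powr p) \<partial>\<nu>) = 1"
    and energy: "(\<Sum>n. \<integral>\<^sup>+x. local_energy q (w n) x \<partial>\<nu>) \<noteq> \<infinity>"
    and mean: "(\<lambda>n. \<integral>x. w n x \<partial>\<nu>) \<longlonglongrightarrow> 0"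
    and cover: "\<And>B. B \<in> null_sets \<nu> \<Longrightarrow> \<exists>I x \<Omega>. controlled_cover q p B I x \<Omega>"
  shows False
proof -
  have AE_energy: "AE x in \<nu>. (\<lambda>n. local_energy q (w n) x) \<longlonglongrightarrow> 0"
    by (rule AE_suminf_finite_imp_tendsto_0[OF _ energy]) measurable
  obtain r v \<Lambda> where r: "strict_mono r" and [measurable]: "v \<in> borel_measurable borel"
    and \<Lambda>: "finite \<Lambda>" "AE y in \<nu>. v y \<in> \<Lambda>"
    and lim: "(\<lambda>n. \<integral>\<^sup>+y. ennreal (\<bar>w (r n) y - v y\<bar> powr p) \<partial>\<nu>) \<longlonglongrightarrow> 0"
  proof -
    have "\<exists>r v \<Lambda>. strict_mono (r::nat\<Rightarrow>nat) \<and> v \<in> borel_measurable borel \<and> finite \<Lambda> \<and> (AE y in \<nu>. v y \<in> \<Lambda>) \<and>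
      (\<lambda>n. \<integral>\<^sup>+y. ennreal (\<bar>w (r n) y - v y\<bar> powr p) \<partial>\<nu>) \<longlonglongrightarrow> 0"
      using p norm by (intro Lp_limit_with_finite_range[OF assms(2) _ _ AE_energy cover]) auto
    then show thesis using that by blast
  qed
  have L1: "(\<lambda>n. \<integral>\<^sup>+y. ennreal \<bar>w (r n) y - v y\<bar> \<partial>\<nu>) \<longlonglongrightarrow> 0"
    by (rule Lp_tendsto_0_imp_L1_tendsto_0[OF _ p(1) lim]) measurable
  obtain s where s: "strict_mono s" "AE x in \<nu>. (\<lambda>n. w (r (s n)) x - v x) \<longlonglongrightarrow> 0"
    using L1_tendsto_0_imp_AE_subseq[OF _ L1] by (auto simp: measurable_cong_sets[OF sets_nu refl])
  have "AE x in \<nu>. AE y in m x. v y = v x"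
  proof (rule AE_constant_on_steps)
    show "AE x in \<nu>. (\<lambda>n. local_energy q (w (r (s n))) x) \<longlonglongrightarrow> 0"
      using AE_energy
    proof eventually_elim
      case (elim x)
      then show ?case using LIMSEQ_subseq_LIMSEQ[OF elim strict_mono_o[OF r s(1)]] by (simp add: o_def)
    qed
    show "AE x in \<nu>. (\<lambda>n. w (r (s n)) x) \<longlonglongrightarrow> v x"
      using s(2) by eventually_elim (simp add: LIM_zero_iff)
  qed (use p in auto)
  then obtain c where c: "AE x in \<nu>. v x = c"
    using constant_if_connected[OF conn _ countable_finite[OF \<Lambda>(1)] \<Lambda>(2)] by auto
  have int_w: "integrable \<nu> (w n)" for n
  proof (rule integrableI_bounded)
    have "(\<integral>\<^sup>+y. ennreal (norm (w n y)) \<partial>\<nu>) \<le> (\<integral>\<^sup>+y. 1 + ennreal (\<bar>w n y\<bar> powr p) \<partial>\<nu>)"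
    proof (rule nn_integral_mono)
      fix y
      have "\<bar>w n y\<bar> \<le> 1 + \<bar>w n y\<bar> powr p"
        using p powr_mono[of 1 p "\<bar>w n y\<bar>"] by (cases "\<bar>w n y\<bar> \<le> 1") (auto intro: add_increasing2 add_increasing)
      then show "ennreal (norm (w n y)) \<le> 1 + ennreal (\<bar>w n y\<bar> powr p)"
        by (simp flip: ennreal_1 ennreal_plus)
    qed
    also have "\<dots> = 1 + 1" by (subst nn_integral_add) (auto simp: norm emeasure_space_1[simplified])
    finally show "(\<integral>\<^sup>+y. ennreal (norm (w n y)) \<partial>\<nu>) < \<infinity>"
      by (rule order.strict_trans1) auto
  qed measurable
  have to_c: "(\<integral>\<^sup>+y. ennreal (\<bar>w (r n) y - v y\<bar> powr a) \<partial>\<nu>) = (\<integral>\<^sup>+y. ennreal (\<bar>w (r n) y - c\<bar> powr a) \<partial>\<nu>)" for n a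
    using c by (intro nn_integral_cong_AE) auto
  have "(\<lambda>n. \<integral>x. w (r n) x \<partial>\<nu>) \<longlonglongrightarrow> (\<integral>x. c \<partial>\<nu>)"
    using int_w L1 to_c[of _ 1] by (intro tendsto_L1_int) auto
  moreover have "(\<lambda>n. \<integral>x. w (r n) x \<partial>\<nu>) \<longlonglongrightarrow> 0"
    using LIMSEQ_subseq_LIMSEQ[OF mean r] by (simp add: o_def)
  ultimately have "c = 0" using LIMSEQ_unique by (auto simp: prob_space[simplified])
  then have "(\<lambda>n. 1 :: ennreal) \<longlonglongrightarrow> 0" using lim to_c[of _ p] norm by simp
  then show False by (simp add: LIMSEQ_const_iff)
qed

end

section \<open>The Poincare inequality\<close>

lemma le_powr_if_ennreal_powr_le:
  assumes "ennreal_powr x (1 / q) \<le> ennreal r" "0 < q" "0 \<le> r"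
  shows "x \<le> ennreal (r powr q)"
proof (cases x)
  case (real a)
  have "a powr (1 / q) \<le> r" if "a \<noteq> 0"
    using assms real that by (simp add: ennreal_powr_def split: if_splits)
  then have "a \<le> r powr q" if "a \<noteq> 0"
    using powr_mono2[of q "a powr (1 / q)" r] assms real that by (simp add: powr_powr)
  then show ?thesis using real by (cases "a = 0") (auto intro: ennreal_leI)
next
  case top
  then show ?thesis using assms by (simp add: ennreal_powr_def top_unique split: if_splits)
qed

context ac_random_walk
begin

text \<open>
  The three terms of the Poincare inequality do not change on passing to a Borel function that is
  \<open>\<nu>\<close>-almost everywhere equal. For the energy this uses that \<open>\<nu>\<close>-null sets are null for every \<open>m x\<close>.
  The integrals over completions turn into ordinary ones because the nonnegative integral of any
  function, measurable or not, is the same for a measure and its completion.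
\<close>

lemma Borel_representative:
  assumes u: "u \<in> borel_measurable (completion \<nu>)"
  obtains v where "v \<in> borel_measurable borel"
    "\<And>p. Lp_norm p \<nu> u = ennreal_powr (\<integral>\<^sup>+x. ennreal (\<bar>v x\<bar> powr p) \<partial>\<nu>) (1 / p)"
    "(\<integral>x. u x \<partial>completion \<nu>) = (\<integral>x. v x \<partial>\<nu>)"
    "\<And>q. (\<integral>\<^sup>+ x. (\<integral>\<^sup>+ y. ennreal (\<bar>u y - u x\<bar> powr q) \<partial>completion (m x)) \<partial>completion \<nu>) = (\<integral>\<^sup>+x. local_energy q v x \<partial>\<nu>)"
proof -
  obtain v where v: "v \<in> borel_measurable \<nu>" and uv: "AE x in \<nu>. u x = v x"
    using completion_ex_borel_measurable_real[OF u] by blast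
  show thesis
  proof (rule that[of v])
    show "v \<in> borel_measurable borel" using v by (simp add: measurable_cong_sets[OF sets_nu refl])
    show "Lp_norm p \<nu> u = ennreal_powr (\<integral>\<^sup>+x. ennreal (\<bar>v x\<bar> powr p) \<partial>\<nu>) (1 / p)" for p
      using uv unfolding Lp_norm_def nn_integral_completion
      by (intro arg_cong2[where f = ennreal_powr] nn_integral_cong_AE refl) auto
    have "(\<integral>x. u x \<partial>completion \<nu>) = (\<integral>x. v x \<partial>completion \<nu>)"
      using AE_completion[OF uv] u measurable_completion[OF v] by (intro integral_cong_AE) auto
    then show "(\<integral>x. u x \<partial>completion \<nu>) = (\<integral>x. v x \<partial>\<nu>)"
      using v by (simp add: integral_completion)
    show "(\<integral>\<^sup>+ x. (\<integral>\<^sup>+ y. ennreal (\<bar>u y - u x\<bar> powr q) \<partial>completion (m x)) \<partial>completion \<nu>) = (\<integral>\<^sup>+x. local_energy q v x \<partial>\<nu>)" for q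
      unfolding nn_integral_completion local_energy_def
    proof (rule nn_integral_cong_AE, use uv in eventually_elim)
      fix x assume "u x = v x"
      then show "(\<integral>\<^sup>+ y. ennreal (\<bar>u y - u x\<bar> powr q) \<partial>m x) = (\<integral>\<^sup>+ y. ennreal (\<bar>v y - v x\<bar> powr q) \<partial>m x)"
        using AE_m[OF uv, of x] by (intro nn_integral_cong_AE) auto
    qed
  qed
qed

text \<open>
  A function that violates the inequality with constant \<open>c\<close>, divided by its \<open>L\<^sup>p\<close> norm. That norm is
  finite because \<open>L\<^sup>q\<close> is contained in \<open>L\<^sup>p\<close>, and nonzero because the inequality fails.
\<close>

lemma normalised_counterexample:
  assumes p: "1 \<le> p" "p \<le> q" and c: "1 \<le> c" and u: "u \<in> Lp_space q \<nu>"
    and fail: "\<not> Lp_norm p \<nu> u \<le> ennreal c *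
       (ennreal_powr (\<integral>\<^sup>+ x. (\<integral>\<^sup>+ y. ennreal (\<bar>u y - u x\<bar> powr q) \<partial>completion (m x)) \<partial>completion \<nu>) (1 / q)
        + ennreal \<bar>\<integral>x. u x \<partial>completion \<nu>\<bar>)"
  obtains w where "w \<in> borel_measurable borel" "(\<integral>\<^sup>+x. ennreal (\<bar>w x\<bar> powr p) \<partial>\<nu>) = 1"
    "(\<integral>\<^sup>+x. local_energy q w x \<partial>\<nu>) \<le> ennreal (1 / c)" "\<bar>\<integral>x. w x \<partial>\<nu>\<bar> \<le> 1 / c"
proof -
  from u have "u \<in> borel_measurable (completion \<nu>)" and uq: "Lp_norm q \<nu> u < \<infinity>"
    by (auto simp: Lp_space_def)
  then obtain v where v [measurable]: "v \<in> borel_measurable borel"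
    and norm: "\<And>p. Lp_norm p \<nu> u = ennreal_powr (\<integral>\<^sup>+x. ennreal (\<bar>v x\<bar> powr p) \<partial>\<nu>) (1 / p)"
    and mean: "(\<integral>x. u x \<partial>completion \<nu>) = (\<integral>x. v x \<partial>\<nu>)"
    and energy: "\<And>q. (\<integral>\<^sup>+ x. (\<integral>\<^sup>+ y. ennreal (\<bar>u y - u x\<bar> powr q) \<partial>completion (m x)) \<partial>completion \<nu>) = (\<integral>\<^sup>+x. local_energy q v x \<partial>\<nu>)"
    by (elim Borel_representative) blast
  define E where "E = (\<integral>\<^sup>+x. local_energy q v x \<partial>\<nu>)"
  have "(\<integral>\<^sup>+x. ennreal (\<bar>v x\<bar> powr q) \<partial>\<nu>) < \<infinity>"
    using uq p by (auto simp: norm ennreal_powr_def less_top split: if_splits)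
  moreover have "(\<integral>\<^sup>+x. ennreal (\<bar>v x\<bar> powr p) \<partial>\<nu>) \<le> (\<integral>\<^sup>+x. 1 + ennreal (\<bar>v x\<bar> powr q) \<partial>\<nu>)"
  proof (rule nn_integral_mono)
    fix x
    have "\<bar>v x\<bar> powr p \<le> 1 + \<bar>v x\<bar> powr q"
      using p powr_mono[of p q "\<bar>v x\<bar>"] powr_mono2[of p "\<bar>v x\<bar>" 1]
      by (cases "\<bar>v x\<bar> \<le> 1") (auto intro: add_increasing2 add_increasing)
    then show "ennreal (\<bar>v x\<bar> powr p) \<le> 1 + ennreal (\<bar>v x\<bar> powr q)"
      by (simp flip: ennreal_1 ennreal_plus)
  qed
  moreover have "\<dots> = 1 + (\<integral>\<^sup>+x. ennreal (\<bar>v x\<bar> powr q) \<partial>\<nu>)"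
    by (subst nn_integral_add) (auto simp: emeasure_space_1[simplified])
  ultimately have "(\<integral>\<^sup>+x. ennreal (\<bar>v x\<bar> powr p) \<partial>\<nu>) < \<infinity>"
    by (auto simp: less_top[symmetric] top_unique)
  then obtain a where a: "(\<integral>\<^sup>+x. ennreal (\<bar>v x\<bar> powr p) \<partial>\<nu>) = ennreal a" "0 \<le> a"
    by (cases "\<integral>\<^sup>+x. ennreal (\<bar>v x\<bar> powr p) \<partial>\<nu>") auto
  have "a \<noteq> 0" using fail norm[of p] a p by (auto simp: ennreal_powr_def)
  define s where "s = a powr (1 / p)"
  have s: "s > 0" "s powr p = a" using a \<open>a \<noteq> 0\<close> p by (auto simp: s_def powr_powr)
  have "Lp_norm p \<nu> u = ennreal s"
    using a \<open>a \<noteq> 0\<close> p by (simp add: norm ennreal_powr_def s_def)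
  with fail have less: "ennreal c * (ennreal_powr E (1 / q) + ennreal \<bar>\<integral>x. v x \<partial>\<nu>\<bar>) \<le> ennreal s"
    by (simp add: energy mean E_def)
  have div: "X \<le> ennreal (s / c)" if "ennreal c * X \<le> ennreal s" for X
  proof -
    have "X = ennreal (1 / c) * (ennreal c * X)"
      using c by (simp add: mult.assoc[symmetric] flip: ennreal_mult)
    also have "\<dots> \<le> ennreal (1 / c) * ennreal s" using that by (rule mult_left_mono) simp
    also have "\<dots> = ennreal (s / c)" using c s by (simp flip: ennreal_mult)
    finally show ?thesis .
  qed
  have "ennreal_powr E (1 / q) \<le> ennreal (s / c)"
    by (rule div) (meson less add_increasing2 mult_left_mono order_refl order_trans zero_le)
  then have E_le: "E \<le> ennreal ((s / c) powr q)"
    using p c s by (intro le_powr_if_ennreal_powr_le) auto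
  have "ennreal \<bar>\<integral>x. v x \<partial>\<nu>\<bar> \<le> ennreal (s / c)"
    by (rule div) (meson less add_increasing mult_left_mono order_refl order_trans zero_le)
  then have mean_le: "\<bar>\<integral>x. v x \<partial>\<nu>\<bar> \<le> s / c"
    using s c by (simp add: ennreal_le_iff)
  have scale: "ennreal (\<bar>t / s\<bar> powr b) = ennreal (1 / s powr b) * ennreal (\<bar>t\<bar> powr b)" for t b
    using s by (simp add: powr_divide flip: ennreal_mult)
  show thesis
  proof (rule that[of "\<lambda>x. v x / s"])
    have "(\<integral>\<^sup>+x. ennreal (\<bar>v x / s\<bar> powr p) \<partial>\<nu>) = ennreal (1 / a) * ennreal a"
      unfolding scale s(2) a(1)[symmetric] by (rule nn_integral_cmult) measurable
    then show "(\<integral>\<^sup>+x. ennreal (\<bar>v x / s\<bar> powr p) \<partial>\<nu>) = 1"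
      using a \<open>a \<noteq> 0\<close> by (simp flip: ennreal_mult)
    have "local_energy q (\<lambda>x. v x / s) x = ennreal (1 / s powr q) * local_energy q v x" for x
      by (simp add: local_energy_def scale nn_integral_cmult del: abs_divide flip: diff_divide_distrib)
    then have "(\<integral>\<^sup>+x. local_energy q (\<lambda>x. v x / s) x \<partial>\<nu>) = ennreal (1 / s powr q) * E"
      by (simp add: nn_integral_cmult E_def)
    also have "\<dots> \<le> ennreal (1 / s powr q) * ennreal ((s / c) powr q)"
      using E_le by (rule mult_left_mono) simp
    also have "\<dots> = ennreal ((1 / c) powr q)"
      using s c by (simp add: powr_divide flip: ennreal_mult)
    also have "\<dots> \<le> ennreal (1 / c)"
      using powr_mono'[of 1 q "1 / c"] p c by (intro ennreal_leI) simp
    finally show "(\<integral>\<^sup>+x. local_energy q (\<lambda>x. v x / s) x \<partial>\<nu>) \<le> ennreal (1 / c)" .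
    show "\<bar>\<integral>x. v x / s \<partial>\<nu>\<bar> \<le> 1 / c"
      using mean_le s c by (simp add: field_simps)
  qed measurable
qed

text \<open>
  Violations of the inequality with constants \<open>2\<^sup>n\<close> give a degenerate sequence: the powers of two
  make the energies summable.
\<close>

lemma poincare_if_controlled_covers:
  assumes conn: "m_connected m \<nu>" and p: "1 \<le> p" "p \<le> q"
    and cover: "\<And>B. B \<in> null_sets \<nu> \<Longrightarrow> \<exists>I x \<Omega>. controlled_cover q p B I x \<Omega>"
  shows "poincare_inequality m \<nu> q p"
proof (rule ccontr)
  assume fail: "\<not> ?thesis"
  have "\<exists>w. w \<in> borel_measurable borel \<and> (\<integral>\<^sup>+x. ennreal (\<bar>w x\<bar> powr p) \<partial>\<nu>) = 1 \<and>
    (\<integral>\<^sup>+x. local_energy q w x \<partial>\<nu>) \<le> ennreal (1 / 2 ^ n) \<and> \<bar>\<integral>x. w x \<partial>\<nu>\<bar> \<le> 1 / 2 ^ n" for n :: nat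
  proof -
    have "(2::real) ^ n > 0" "(2::real) ^ n \<ge> 1" by auto
    with fail obtain u where "u \<in> Lp_space q \<nu>"
      "\<not> Lp_norm p \<nu> u \<le> ennreal (2 ^ n) *
       (ennreal_powr (\<integral>\<^sup>+ x. (\<integral>\<^sup>+ y. ennreal (\<bar>u y - u x\<bar> powr q) \<partial>completion (m x)) \<partial>completion \<nu>) (1 / q)
        + ennreal \<bar>\<integral>x. u x \<partial>completion \<nu>\<bar>)"
      unfolding poincare_inequality_def by blast
    from normalised_counterexample[OF p \<open>(2::real) ^ n \<ge> 1\<close> this] show ?thesis by blast
  qed
  then obtain w where w: "\<And>n. w n \<in> borel_measurable borel" "\<And>n. (\<integral>\<^sup>+x. ennreal (\<bar>w n x\<bar> powr p) \<partial>\<nu>) = 1"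
    "\<And>n. (\<integral>\<^sup>+x. local_energy q (w n) x \<partial>\<nu>) \<le> ennreal (1 / 2 ^ n)" "\<And>n. \<bar>\<integral>x. w n x \<partial>\<nu>\<bar> \<le> 1 / 2 ^ n"
    by metis
  have geo: "summable (\<lambda>n. 1 / 2 ^ n :: real)"
    using summable_geometric[of "1 / 2 :: real"] by (simp add: power_divide)
  show False
  proof (rule no_degenerate_sequence[OF conn w(1) p w(2) _ _ cover])
    have "(\<Sum>n. \<integral>\<^sup>+x. local_energy q (w n) x \<partial>\<nu>) \<le> (\<Sum>n. ennreal (1 / 2 ^ n))"
      by (rule suminf_le[OF w(3) summableI summableI])
    moreover have "(\<Sum>n. ennreal (1 / 2 ^ n)) \<noteq> top"
      by (rule ennreal_suminf_neq_top[OF geo]) simp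
    ultimately show "(\<Sum>n. \<integral>\<^sup>+x. local_energy q (w n) x \<partial>\<nu>) \<noteq> \<infinity>"
      by (metis infinity_ennreal_def top_unique)
    show "(\<lambda>n. \<integral>x. w n x \<partial>\<nu>) \<longlonglongrightarrow> 0"
      using w(4) by (intro Lim_null_comparison[OF _ summable_LIMSEQ_zero[OF geo]]) auto
  qed
qed

text \<open>
  Replaces sets of the completion by their Borel main parts, from which they differ by null sets.
\<close>

lemma controlled_cover_main_part:
  assumes cover: "(\<Union>i\<in>I. \<Omega> i) = UNIV" and I: "finite I"
    and sets: "\<And>i. i \<in> I \<Longrightarrow> x i \<notin> B \<and> \<Omega> i \<in> sets (completion \<nu>)"
    and ctrl: "\<And>i. i \<in> I \<Longrightarrow> Lp_controls q p (density \<nu> (RN_deriv \<nu> (m (x i)))) \<nu> (main_part \<nu> (\<Omega> i))"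
  shows "controlled_cover q p B I x (\<lambda>i. main_part \<nu> (\<Omega> i))"
proof -
  have "AE y in \<nu>. \<forall>i\<in>I. y \<in> main_part \<nu> (\<Omega> i) \<longleftrightarrow> y \<in> \<Omega> i"
    using sets I by (intro AE_finite_allI AE_in_main_part) auto
  then have "AE y in \<nu>. \<exists>i\<in>I. y \<in> main_part \<nu> (\<Omega> i)"
    using cover by (elim eventually_mono) blast
  then show ?thesis
    using sets I ctrl main_part_sets[of _ \<nu>] by (auto simp: controlled_cover_def density_m sets_nu)
qed

lemma poincare_if_density_bounded_below:
  assumes conn: "m_connected m \<nu>" and p: "1 \<le> p"
    and H: "\<forall>B\<in>null_sets (completion \<nu>).
      \<exists>(N::nat) (x :: nat \<Rightarrow> 'a) (\<Omega> :: nat \<Rightarrow> 'a set) (\<alpha>::real).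
        \<alpha> > 0 \<and>
        (\<Union>i\<in>{1..N}. \<Omega> i) = UNIV \<and>
        (\<forall>i\<in>{1..N}. x i \<notin> B \<and> \<Omega> i \<in> sets (completion \<nu>) \<and>
           (AE y in completion \<nu>. y \<in> \<Omega> i \<longrightarrow> RN_deriv \<nu> (m (x i)) y \<ge> ennreal \<alpha>))"
  shows "poincare_inequality m \<nu> p p"
proof (rule poincare_if_controlled_covers[OF conn p order_refl])
  fix B assume "B \<in> null_sets \<nu>"
  from bspec[OF H null_sets_completionI[OF this]]
  obtain N :: nat and x \<Omega> \<alpha> where "\<alpha> > 0 \<and> (\<Union>i\<in>{1..N}. \<Omega> i) = UNIV \<and>
      (\<forall>i\<in>{1..N}. x i \<notin> B \<and> \<Omega> i \<in> sets (completion \<nu>) \<and>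
         (AE y in completion \<nu>. y \<in> \<Omega> i \<longrightarrow> RN_deriv \<nu> (m (x i)) y \<ge> ennreal \<alpha>))"
    by (elim exE)
  then have \<alpha>: "\<alpha> > 0" and cover: "(\<Union>i\<in>{1..N}. \<Omega> i) = UNIV"
    and i: "\<And>i. i \<in> {1..N} \<Longrightarrow> x i \<notin> B \<and> \<Omega> i \<in> sets (completion \<nu>)"
      "\<And>i. i \<in> {1..N} \<Longrightarrow> AE y in completion \<nu>. y \<in> \<Omega> i \<longrightarrow> RN_deriv \<nu> (m (x i)) y \<ge> ennreal \<alpha>"
    by fast+
  have "controlled_cover p p B {1..N} x (\<lambda>i. main_part \<nu> (\<Omega> i))"
  proof (rule controlled_cover_main_part[OF cover _ i(1)])
    fix i assume "i \<in> {1..N}"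
    then have "AE y in \<nu>. y \<in> main_part \<nu> (\<Omega> i) \<longrightarrow> RN_deriv \<nu> (m (x i)) y \<ge> ennreal \<alpha>"
      using i(2)[of i] AE_in_main_part[of "\<Omega> i" \<nu>] i(1)[of i] by (auto simp: AE_completion_iff)
    then show "Lp_controls p p (density \<nu> (RN_deriv \<nu> (m (x i)))) \<nu> (main_part \<nu> (\<Omega> i))"
      using \<alpha> by (intro Lp_controls_density_bounded_below) auto
  qed auto
  then show "\<exists>I x \<Omega>. controlled_cover p p B I x \<Omega>" by blast
qed

lemma poincare_if_density_powr_integrable:
  assumes conn: "m_connected m \<nu>" and p: "1 \<le> p" "p < q"
    and H: "\<forall>B\<in>null_sets (completion \<nu>).
      \<exists>(N::nat) (x :: nat \<Rightarrow> 'a) (\<Omega> :: nat \<Rightarrow> 'a set).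
        (\<Union>i\<in>{1..N}. \<Omega> i) = UNIV \<and>
        (\<forall>i\<in>{1..N}. x i \<notin> B \<and> \<Omega> i \<in> sets (completion \<nu>) \<and>
           (\<integral>\<^sup>+ y\<in>\<Omega> i. ennreal_powr (RN_deriv \<nu> (m (x i)) y) (- (p / (q - p))) \<partial>completion \<nu>)
             < \<infinity>)"
  shows "poincare_inequality m \<nu> q p"
proof (rule poincare_if_controlled_covers[OF conn p(1) less_imp_le[OF p(2)]])
  fix B assume "B \<in> null_sets \<nu>"
  from bspec[OF H null_sets_completionI[OF this]]
  obtain N :: nat and x \<Omega> where "(\<Union>i\<in>{1..N}. \<Omega> i) = UNIV \<and>
      (\<forall>i\<in>{1..N}. x i \<notin> B \<and> \<Omega> i \<in> sets (completion \<nu>) \<and>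
         (\<integral>\<^sup>+ y\<in>\<Omega> i. ennreal_powr (RN_deriv \<nu> (m (x i)) y) (- (p / (q - p))) \<partial>completion \<nu>) < \<infinity>)"
    by (elim exE)
  then have cover: "(\<Union>i\<in>{1..N}. \<Omega> i) = UNIV"
    and i: "\<And>i. i \<in> {1..N} \<Longrightarrow> x i \<notin> B \<and> \<Omega> i \<in> sets (completion \<nu>)"
      "\<And>i. i \<in> {1..N} \<Longrightarrow> (\<integral>\<^sup>+ y\<in>\<Omega> i. ennreal_powr (RN_deriv \<nu> (m (x i)) y) (- (p / (q - p))) \<partial>completion \<nu>) < \<infinity>"
    by fast+
  have "controlled_cover q p B {1..N} x (\<lambda>i. main_part \<nu> (\<Omega> i))"
  proof (rule controlled_cover_main_part[OF cover _ i(1)])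
    fix i assume "i \<in> {1..N}"
    note i = i[OF this]
    have "(\<integral>\<^sup>+ y\<in>main_part \<nu> (\<Omega> i). ennreal_powr (RN_deriv \<nu> (m (x i)) y) (- (p / (q - p))) \<partial>\<nu>)
      = (\<integral>\<^sup>+ y\<in>\<Omega> i. ennreal_powr (RN_deriv \<nu> (m (x i)) y) (- (p / (q - p))) \<partial>\<nu>)"
      using AE_in_main_part[of "\<Omega> i" \<nu>] i(1)
      by (intro nn_integral_cong_AE) (auto simp: indicator_def elim: eventually_mono)
    then show "Lp_controls q p (density \<nu> (RN_deriv \<nu> (m (x i)))) \<nu> (main_part \<nu> (\<Omega> i))"
      using i p by (intro Lp_controls_density_integrable_powr) (auto simp: nn_integral_completion)
  qed auto
  then show "\<exists>I x \<Omega>. controlled_cover q p B I x \<Omega>" by blast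
qed

end

theorem theorem4p5:
  fixes m :: "'a::polish_space \<Rightarrow> 'a measure" and \<nu> :: "'a measure"
  assumes "metric_random_walk m"
    and "radon_measure \<nu>"
    and "invariant_measure m \<nu>"
    and "reversible_measure m \<nu>"
    and "m_connected m \<nu>"
    and "prob_space \<nu>"
    and "\<And>x. absolutely_continuous \<nu> (m x)"
  shows
    "((\<forall>B\<in>null_sets (completion \<nu>).
         \<exists>(N::nat) (x :: nat \<Rightarrow> 'a) (\<Omega> :: nat \<Rightarrow> 'a set) (\<alpha>::real).
           \<alpha> > 0 \<and>
           (\<Union>i\<in>{1..N}. \<Omega> i) = UNIV \<and>
           (\<forall>i\<in>{1..N}. x i \<notin> B \<and> \<Omega> i \<in> sets (completion \<nu>) \<and>
              (AE y in completion \<nu>. y \<in> \<Omega> i \<longrightarrow> RN_deriv \<nu> (m (x i)) y \<ge> ennreal \<alpha>)))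
       \<longrightarrow> (\<forall>p::real. p \<ge> 1 \<longrightarrow> poincare_inequality m \<nu> p p))
     \<and>
     (\<forall>p q :: real. 1 \<le> p \<longrightarrow> p < q \<longrightarrow>
       (\<forall>B\<in>null_sets (completion \<nu>).
         \<exists>(N::nat) (x :: nat \<Rightarrow> 'a) (\<Omega> :: nat \<Rightarrow> 'a set).
           (\<Union>i\<in>{1..N}. \<Omega> i) = UNIV \<and>
           (\<forall>i\<in>{1..N}. x i \<notin> B \<and> \<Omega> i \<in> sets (completion \<nu>) \<and>
              (\<integral>\<^sup>+ y\<in>\<Omega> i. ennreal_powr (RN_deriv \<nu> (m (x i)) y) (- (p / (q - p))) \<partial>completion \<nu>)
                < \<infinity>))
       \<longrightarrow> poincare_inequality m \<nu> q p)"
proof -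
  have sets: "sets \<nu> = sets borel" using assms(2) by (simp add: radon_measure_def)
  have walk: "ac_random_walk \<nu> m"
  proof (intro ac_random_walk.intro ac_random_walk_axioms.intro)
    show "prob_space \<nu>" by fact
    show "m \<in> \<nu> \<rightarrow>\<^sub>M prob_algebra borel"
    proof (rule measurable_prob_algebraI[OF _ measurable_subprob_algebra])
      fix x
      show "prob_space (m x)" "sets (m x) = sets borel" "subprob_space (m x)"
        using assms(1) by (auto simp: metric_random_walk_def intro!: prob_space_imp_subprob_space)
    next
      fix A :: "'a set" assume "A \<in> sets borel"
      moreover have "\<forall>A\<in>sets borel. (\<lambda>x. emeasure (m x) A) \<in> borel_measurable borel"
        using assms(1) unfolding metric_random_walk_def by (elim conjE)
      ultimately have "(\<lambda>x. emeasure (m x) A) \<in> borel_measurable borel" by (rule bspec[rotated])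
      then show "(\<lambda>x. emeasure (m x) A) \<in> borel_measurable \<nu>"
        by (subst measurable_cong_sets[OF sets refl])
    qed
    show "sets \<nu> = sets borel" by (rule sets)
    show "absolutely_continuous \<nu> (m x)" for x by (rule assms(7))
  qed
  show ?thesis
    using ac_random_walk.poincare_if_density_bounded_below[OF walk assms(5)]
      ac_random_walk.poincare_if_density_powr_integrable[OF walk assms(5)]
    by blast
qed

end
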